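(* Let $H$ be a real Hilbert space with inner product $\langle\cdot,\cdot\rangle$, let $q\colon H\to[0,\infty]$ be a closed quadratic form, and let $\Phi\colon H\to[0,\infty]$ be a sublinear functional such that for every $R\ge 0$ the sublevel set $B^\Phi_R=\{f\in H\mid \Phi(f)\le R\}$ is closed and bounded in $H$. Then for every $w\in(\ker q)^\perp$ there exists a decreasing function $\alpha=\alpha_w\colon(0,\infty)\to(0,\infty)$ such that for all $r>0$ and all $f\in H$ $$|\langle w,f\rangle|^2\le \alpha(r)\,q(f)+r\,\Phi(f)^2 .$$
   Context: A quadratic form $q\colon H\to[0,\infty]$ is a map with $q(\lambda f)=\lambda^2q(f)$ for $\lambda\in\mathbb R$ (convention $0\cdot\infty=0$) and $q(f+g)+q(f-g)=2q(f)+2q(g)$. Its domain is the subspace $D(q)=\{f\mid q(f)<\infty\}$ and its kernel is $\ker q=\{f\in H\mid q(f)=0\}$. It is closed if $D(q)$ is complete with respect to the metric $q(f-g)^{1/2}+\|f-g\|$; equivalently, $q$ is lower semicontinuous on $H$. Sublinear means subadditive and positively homogeneous. The orthogonal complement is taken in $H$. Decreasing means nonincreasing. *)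

theory Defs
  imports "HOL-Analysis.Analysis"
begin

text \<open>Multiplication in \<open>ennreal\<close> satisfies \<open>0 * \<infinity> = 0\<close>, which is the convention for \<open>c = 0\<close> below.\<close>

definition quadratic_form :: "('a::real_inner \<Rightarrow> ennreal) \<Rightarrow> bool" where
  "quadratic_form q \<longleftrightarrow>
     (\<forall>c f. q (c *\<^sub>R f) = ennreal (c\<^sup>2) * q f) \<and>
     (\<forall>f g. q (f + g) + q (f - g) = 2 * q f + 2 * q g)"

definition form_domain :: "('a::real_inner \<Rightarrow> ennreal) \<Rightarrow> 'a set" where
  "form_domain q = {f. q f < \<infinity>}"

definition form_kernel :: "('a::real_inner \<Rightarrow> ennreal) \<Rightarrow> 'a set" where
  "form_kernel q = {f. q f = 0}"

text \<open>This is used on the domain of the form only, where \<open>q (f - g)\<close> is finite and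
  \<open>enn2real\<close> therefore loses nothing; see \<open>Metric_space_form_dist\<close> below.\<close>

definition form_dist :: "('a::real_inner \<Rightarrow> ennreal) \<Rightarrow> 'a \<Rightarrow> 'a \<Rightarrow> real" where
  "form_dist q f g = sqrt (enn2real (q (f - g))) + norm (f - g)"

definition closed_form :: "('a::real_inner \<Rightarrow> ennreal) \<Rightarrow> bool" where
  "closed_form q \<longleftrightarrow> Metric_space.mcomplete (form_domain q) (form_dist q)"

text \<open>Positive homogeneity is required for \<open>c > 0\<close> only. For \<open>c = 0\<close> it would say \<open>\<Phi> 0 = 0\<close>;
  without this, \<open>\<Phi> 0 = \<infinity>\<close> is possible as well.\<close>

definition sublinear :: "('a::real_inner \<Rightarrow> ennreal) \<Rightarrow> bool" where
  "sublinear \<Phi> \<longleftrightarrow>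
     (\<forall>f g. \<Phi> (f + g) \<le> \<Phi> f + \<Phi> g) \<and>
     (\<forall>c f. 0 < c \<longrightarrow> \<Phi> (c *\<^sub>R f) = ennreal c * \<Phi> f)"

lemma form_domain_scaleR:
  assumes "quadratic_form q" "f \<in> form_domain q"
  shows "c *\<^sub>R f \<in> form_domain q"
  using assms by (auto simp: quadratic_form_def form_domain_def ennreal_mult_less_top)

lemma form_domain_add_diff:
  assumes q: "quadratic_form q" and f: "f \<in> form_domain q" and g: "g \<in> form_domain q"
  shows "f + g \<in> form_domain q" "f - g \<in> form_domain q"
proof -
  have "q (f + g) + q (f - g) = 2 * q f + 2 * q g"
    using q by (auto simp: quadratic_form_def)
  also have "\<dots> < \<infinity>"
    using f g by (auto simp: form_domain_def ennreal_mult_less_top)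
  finally show "f + g \<in> form_domain q" "f - g \<in> form_domain q"
    by (auto simp: form_domain_def)
qed

lemma enn2real_form_scaleR:
  assumes "quadratic_form q"
  shows "enn2real (q (c *\<^sub>R f)) = c\<^sup>2 * enn2real (q f)"
  using assms by (auto simp: quadratic_form_def enn2real_mult)

lemma enn2real_form_parallelogram:
  assumes q: "quadratic_form q" and f: "f \<in> form_domain q" and g: "g \<in> form_domain q"
  shows "enn2real (q (f + g)) + enn2real (q (f - g)) = 2 * enn2real (q f) + 2 * enn2real (q g)"
proof -
  have "enn2real (q (f + g)) + enn2real (q (f - g)) = enn2real (q (f + g) + q (f - g))"
    using form_domain_add_diff[OF assms] by (simp add: form_domain_def enn2real_plus)
  also have "\<dots> = enn2real (2 * q f + 2 * q g)"
    using q by (auto simp: quadratic_form_def)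
  also have "\<dots> = 2 * enn2real (q f) + 2 * enn2real (q g)"
    using f g by (simp add: form_domain_def enn2real_plus enn2real_mult ennreal_mult_less_top)
  finally show ?thesis .
qed

lemma enn2real_form_add_scaleR:
  fixes n :: nat
  assumes q: "quadratic_form q" and f: "f \<in> form_domain q" and g: "g \<in> form_domain q"
  defines "Q \<equiv> \<lambda>h. enn2real (q h)"
  shows "Q (f + real n *\<^sub>R g) = Q f + real n * (Q (f + g) - Q f - Q g) + (real n)\<^sup>2 * Q g"
proof (induction n rule: less_induct)
  case (less n)
  consider "n = 0" | "n = 1" | k where "n = Suc (Suc k)"
    by (metis One_nat_def old.nat.exhaust)
  then show ?case
  proof cases
    case (3 k)
    have "f + real (Suc k) *\<^sub>R g \<in> form_domain q"
      using q f g by (intro form_domain_add_diff form_domain_scaleR)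
    from enn2real_form_parallelogram[OF q this g]
    have "Q (f + real (Suc (Suc k)) *\<^sub>R g) + Q (f + real k *\<^sub>R g)
        = 2 * Q (f + real (Suc k) *\<^sub>R g) + 2 * Q g"
      by (simp add: Q_def algebra_simps scaleR_2)
    with less.IH[of k] less.IH[of "Suc k"] 3 show ?thesis
      by (simp add: algebra_simps power2_eq_square)
  qed (simp_all add: Q_def)
qed

lemma sqrt_form_triangle:
  assumes q: "quadratic_form q" and f: "f \<in> form_domain q" and g: "g \<in> form_domain q"
  shows "sqrt (enn2real (q (f + g))) \<le> sqrt (enn2real (q f)) + sqrt (enn2real (q g))"
proof -
  define Q where "Q h = enn2real (q h)" for h
  define C where "C = Q (f + g) - Q f - Q g"
  have Q0: "Q h \<ge> 0" for h by (simp add: Q_def)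
  have sc: "Q (c *\<^sub>R h) = c\<^sup>2 * Q h" for c h
    unfolding Q_def by (rule enn2real_form_scaleR[OF q])
  have nat: "(real m)\<^sup>2 * Q f - real m * real n * C + (real n)\<^sup>2 * Q g \<ge> 0" for m n :: nat
  proof -
    have m: "real m *\<^sub>R f \<in> form_domain q" and n: "real n *\<^sub>R g \<in> form_domain q"
      using q f g by (auto intro: form_domain_scaleR)
    have "Q (g + real m *\<^sub>R f) = Q g + real m * (Q (g + f) - Q g - Q f) + (real m)\<^sup>2 * Q f"
      unfolding Q_def by (rule enn2real_form_add_scaleR[OF q g f])
    moreover have "Q (real m *\<^sub>R f + real n *\<^sub>R g) = Q (real m *\<^sub>R f)
        + real n * (Q (real m *\<^sub>R f + g) - Q (real m *\<^sub>R f) - Q g) + (real n)\<^sup>2 * Q g"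
      unfolding Q_def by (rule enn2real_form_add_scaleR[OF q m g])
    moreover have "Q (g + f) - Q g - Q f = C"
      by (simp add: C_def add.commute)
    ultimately have "Q (real m *\<^sub>R f + real n *\<^sub>R g)
        = (real m)\<^sup>2 * Q f + real n * (real m * C) + (real n)\<^sup>2 * Q g"
      by (simp add: sc add.commute)
    then have "Q (real m *\<^sub>R f + real n *\<^sub>R g)
        = (real m)\<^sup>2 * Q f + real m * real n * C + (real n)\<^sup>2 * Q g"
      by simp
    moreover have "Q (real m *\<^sub>R f + real n *\<^sub>R g) + Q (real m *\<^sub>R f - real n *\<^sub>R g)
        = 2 * Q (real m *\<^sub>R f) + 2 * Q (real n *\<^sub>R g)"
      unfolding Q_def by (rule enn2real_form_parallelogram[OF q m n])
    ultimately show ?thesis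
      using Q0[of "real m *\<^sub>R f - real n *\<^sub>R g"] by (simp add: sc mult.commute)
  qed
  have real: "x\<^sup>2 * Q f - x * C + Q g \<ge> 0" if "x \<ge> 0" for x
  proof -
    define X where "X n = real (nat \<lfloor>x * real (Suc n)\<rfloor>) / real (Suc n)" for n
    have upper: "X n \<le> x" for n
      using that by (simp add: X_def divide_simps)
    have lower: "x - 1 / real (Suc n) \<le> X n" for n
    proof -
      have "0 \<le> x * real (Suc n)"
        using that by simp
      then have "x * real (Suc n) - 1 \<le> real (nat \<lfloor>x * real (Suc n)\<rfloor>)"
        by linarith
      then have "(x * real (Suc n) - 1) / real (Suc n) \<le> X n"
        unfolding X_def by (intro divide_right_mono) auto
      then show ?thesis
        by (simp add: diff_divide_distrib)
    qed
    have "(\<lambda>n. x - 1 / real (Suc n)) \<longlonglongrightarrow> x - 0"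
      by (intro tendsto_intros LIMSEQ_Suc lim_1_over_n)
    then have X: "X \<longlonglongrightarrow> x"
      using tendsto_sandwich[of "\<lambda>n. x - 1 / real (Suc n)" X sequentially "\<lambda>_. x" x] upper lower
      by simp
    have "0 \<le> (X n)\<^sup>2 * Q f - X n * C + Q g" for n
    proof -
      have "0 \<le> ((real (nat \<lfloor>x * real (Suc n)\<rfloor>))\<^sup>2 * Q f
          - real (nat \<lfloor>x * real (Suc n)\<rfloor>) * real (Suc n) * C + (real (Suc n))\<^sup>2 * Q g)
          / (real (Suc n))\<^sup>2"
        by (intro divide_nonneg_nonneg nat) auto
      also have "\<dots> = (X n)\<^sup>2 * Q f - X n * C + Q g"
        unfolding X_def by (simp only: add_divide_distrib diff_divide_distrib) (simp add: power2_eq_square)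
      finally show ?thesis .
    qed
    moreover have "(\<lambda>n. (X n)\<^sup>2 * Q f - X n * C + Q g) \<longlonglongrightarrow> x\<^sup>2 * Q f - x * C + Q g"
      by (intro tendsto_intros X)
    ultimately show ?thesis
      by (intro LIMSEQ_le_const) auto
  qed
  have "C \<le> 2 * sqrt (Q f) * sqrt (Q g)"
  proof (cases "C \<le> 0")
    case True
    then show ?thesis
      using Q0 by (meson mult_nonneg_nonneg order_trans real_sqrt_ge_zero zero_le_numeral)
  next
    case False
    have "Q f > 0"
    proof (rule ccontr)
      assume "\<not> Q f > 0"
      then have "Q f = 0" using Q0[of f] by simp
      with real[of "(Q g + 1) / C"] False Q0[of g] show False
        by simp
    qed
    with real[of "C / (2 * Q f)"] False have "C\<^sup>2 \<le> 4 * Q f * Q g"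
      by (simp add: power2_eq_square field_simps)
    then have "C \<le> sqrt (4 * Q f * Q g)"
      by (rule real_le_rsqrt)
    then show ?thesis
      by (simp add: real_sqrt_mult)
  qed
  then have "Q (f + g) \<le> (sqrt (Q f) + sqrt (Q g))\<^sup>2"
    using Q0 by (simp add: C_def power2_sum)
  then show ?thesis
    using Q0 by (simp add: Q_def real_le_lsqrt)
qed

lemma Metric_space_form_dist:
  assumes q: "quadratic_form q"
  shows "Metric_space (form_domain q) (form_dist q)"
proof
  show "0 \<le> form_dist q f g" for f g
    by (simp add: form_dist_def)
  show "form_dist q f g = form_dist q g f" for f g
    using enn2real_form_scaleR[OF q, of "-1" "f - g"]
    by (simp add: form_dist_def norm_minus_commute)
  show "form_dist q f g = 0 \<longleftrightarrow> f = g" for f g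
  proof
    assume "form_dist q f g = 0"
    moreover have "norm (f - g) \<le> form_dist q f g"
      by (simp add: form_dist_def)
    ultimately show "f = g" by simp
  next
    assume "f = g"
    then show "form_dist q f g = 0"
      using enn2real_form_scaleR[OF q, of 0 0] by (simp add: form_dist_def)
  qed
  show "form_dist q f h \<le> form_dist q f g + form_dist q g h"
    if "f \<in> form_domain q" "g \<in> form_domain q" "h \<in> form_domain q" for f g h
    using sqrt_form_triangle[OF q, of "f - g" "g - h"] that norm_triangle_ineq[of "f - g" "g - h"]
    by (auto simp: form_dist_def form_domain_add_diff[OF q])
qed

end

theory Submission
  imports Defs
begin

text \<open>After scaling to \<open>\<bar>w \<bullet> f\<bar> = 1\<close>, the term \<open>r \<Phi>(f)\<^sup>2\<close> suffices unless \<open>\<Phi> f \<le> 1 / sqrt r\<close>, and then \<open>f\<close> is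
  bounded; replacing \<open>f\<close> by \<open>- f\<close> if necessary, it suffices to bound \<open>q\<close> away
  from \<open>0\<close> on \<open>{f. w \<bullet> f = 1 \<and> norm f \<le> M}\<close>. If that were impossible, the nested convex sets
  \<open>{f. w \<bullet> f = 1 \<and> q f \<le> 1 / (n + 1)}\<close> would contain points of bounded norm, and almost minimal
  points of these sets form a Cauchy sequence, first in norm (as in the Hilbert projection theorem)
  and then also for the form distance. By closedness its limit lies in the kernel of \<open>q\<close> and has
  inner product \<open>1\<close> with \<open>w\<close>, which contradicts \<open>w \<in> (ker q)\<^sup>\<bottom>\<close>.
  The constants admissible for \<open>r\<close> remain admissible for larger \<open>r\<close>, so their infimum is
  decreasing in \<open>r\<close>; adding \<open>1\<close> makes it positive and admissible.\<close>

text \<open>The parallelogram law, solved for the distance: two points of almost minimal norm are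
  close if their midpoint cannot be much shorter.\<close>

lemma dist_sq_midpoint:
  fixes x y :: "'a::real_inner"
  shows "(dist x y)\<^sup>2 = 2 * (norm x)\<^sup>2 + 2 * (norm y)\<^sup>2 - 4 * (norm ((1/2) *\<^sub>R (x + y)))\<^sup>2"
  by (simp add: dist_norm power2_norm_eq_inner algebra_simps inner_commute power_divide)

text \<open>As \<open>K n\<close> shrinks, the infimum of the squared norm over it grows, but never
  beyond \<open>M\<^sup>2\<close>, so these infima converge. Almost minimal points then have nearly
  the same norm as their midpoints, which forces them together.\<close>

lemma nested_midconvex_Cauchy_selection:
  fixes K :: "nat \<Rightarrow> 'a::real_inner set"
  assumes dec: "decseq K"
    and mid: "\<And>n x y. x \<in> K n \<Longrightarrow> y \<in> K n \<Longrightarrow> (1/2) *\<^sub>R (x + y) \<in> K n"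
    and bdd: "\<And>n. \<exists>x\<in>K n. norm x \<le> M"
  obtains g where "\<And>n. g n \<in> K n" "Cauchy g"
proof -
  define I where "I n = (INF x\<in>K n. (norm x)\<^sup>2)" for n
  have bb: "bdd_below ((\<lambda>x. (norm x)\<^sup>2) ` K n)" for n
    by (rule bdd_belowI[of _ 0]) auto
  have ne: "K n \<noteq> {}" for n
    using bdd[of n] by auto
  have I_le: "I n \<le> (norm x)\<^sup>2" if "x \<in> K n" for n x
    unfolding I_def using bb that by (rule cINF_lower)
  have "incseq I"
    unfolding incseq_def I_def using ne bb decseqD[OF dec] by (intro allI impI cINF_superset_mono) simp_all
  moreover have "I n \<le> M\<^sup>2" for n
  proof -
    obtain x where "x \<in> K n" "norm x \<le> M" using bdd by blast
    then show ?thesis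
      using I_le[of x n] power_mono[of "norm x" M 2] by simp
  qed
  ultimately obtain L where L: "I \<longlonglongrightarrow> L" and I_L: "\<And>n. I n \<le> L"
    by (meson incseq_convergent)
  have "\<exists>x\<in>K n. (norm x)\<^sup>2 < I n + 1 / real (Suc n)" for n
    using cInf_lessD[of "(\<lambda>x. (norm x)\<^sup>2) ` K n" "I n + 1 / real (Suc n)"] ne
    by (auto simp: I_def)
  then obtain g where g: "\<And>n. g n \<in> K n" and g_less: "\<And>n. (norm (g n))\<^sup>2 < I n + 1 / real (Suc n)"
    by metis
  \<comment> \<open>Both points and their midpoint lie in \<open>K N\<close>: the points have
    squared norm at most \<open>L + 1 / (N + 1)\<close>, the midpoint at least
    \<open>I N\<close>.\<close>
  have dist: "(dist (g m) (g n))\<^sup>2 \<le> 4 * (L - I N) + 4 / real (Suc N)"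
    if "N \<le> m" "N \<le> n" for N m n
  proof -
    have "(1/2) *\<^sub>R (g m + g n) \<in> K N"
      using g that decseqD[OF dec] by (intro mid) blast+
    then have "I N \<le> (norm ((1/2) *\<^sub>R (g m + g n)))\<^sup>2"
      by (rule I_le)
    moreover have near: "(norm (g k))\<^sup>2 \<le> L + 1 / real (Suc N)" if "N \<le> k" for k
    proof -
      have "1 / real (Suc k) \<le> 1 / real (Suc N)"
        using that by (simp add: frac_le)
      then show ?thesis
        using g_less[of k] I_L[of k] by linarith
    qed
    ultimately show ?thesis
      using near[OF that(1)] near[OF that(2)] dist_sq_midpoint[of "g m" "g n"] by simp
  qed
  have lim: "(\<lambda>N. 4 * (L - I N) + 4 / real (Suc N)) \<longlonglongrightarrow> 4 * (L - L) + 0"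
    by (intro tendsto_intros L LIMSEQ_Suc[OF lim_const_over_n])
  have "Cauchy g"
  proof (rule metric_CauchyI)
    fix e :: real assume e: "0 < e"
    then obtain N where N: "4 * (L - I N) + 4 / real (Suc N) < e\<^sup>2"
      using order_tendstoD(2)[OF lim, of "e\<^sup>2"] by (auto simp: eventually_sequentially)
    have "dist (g m) (g n) < e" if "m \<ge> N" "n \<ge> N" for m n
      using dist[OF that] N e by (intro power2_less_imp_less[of _ e]) auto
    then show "\<exists>N. \<forall>m\<ge>N. \<forall>n\<ge>N. dist (g m) (g n) < e" by blast
  qed
  with g that show thesis by blast
qed

lemma form_add_le:
  assumes "quadratic_form q"
  shows "q (f + g) \<le> 2 * q f + 2 * q g" "q (f - g) \<le> 2 * q f + 2 * q g"
proof -
  have "q (f + g) + q (f - g) = 2 * q f + 2 * q g"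
    using assms by (simp add: quadratic_form_def)
  then show "q (f + g) \<le> 2 * q f + 2 * q g" "q (f - g) \<le> 2 * q f + 2 * q g"
    by (metis le_iff_add, metis add.commute le_iff_add)
qed

text \<open>Dropping \<open>q (f - g)\<close> from the parallelogram law leaves
  \<open>q (f + g) \<le> 4 * c\<close>, and halving the argument divides by 4. Hence sublevel sets
  of \<open>q\<close> are closed under midpoints, as the selection of a Cauchy sequence
  requires.\<close>

lemma form_midpoint_le:
  assumes q: "quadratic_form q" and "q f \<le> c" "q g \<le> c"
  shows "q ((1/2) *\<^sub>R (f + g)) \<le> c"
proof -
  have "q (f + g) \<le> 2 * c + 2 * c"
    using form_add_le(1)[OF q, of f g] assms(2,3) by (meson add_mono mult_left_mono order_trans zero_le)
  also have "\<dots> = 4 * c"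
    by (simp flip: distrib_right)
  finally have "ennreal (1/4) * q (f + g) \<le> ennreal (1/4) * (4 * c)"
    by (rule mult_left_mono) simp
  also have "\<dots> = (ennreal (1/4) * ennreal 4) * c"
    by (simp only: mult.assoc ennreal_numeral zero_le_numeral)
  also have "\<dots> = c"
    by (simp flip: ennreal_mult del: ennreal_numeral)
  finally show ?thesis
    using q by (simp add: quadratic_form_def power_divide)
qed

lemma form_bounded_below_on_slice:
  fixes q :: "'a::real_inner \<Rightarrow> ennreal"
  assumes q: "quadratic_form q" and closed: "closed_form q"
    and w: "w \<in> orthogonal_comp (form_kernel q)"
  obtains \<delta> :: real where "\<delta> > 0" "\<And>f. w \<bullet> f = 1 \<Longrightarrow> norm f \<le> M \<Longrightarrow> ennreal \<delta> < q f"
proof (rule ccontr)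
  assume "\<not> thesis"
  with that have bad: "\<exists>f. w \<bullet> f = 1 \<and> norm f \<le> M \<and> q f \<le> ennreal \<delta>" if "\<delta> > 0" for \<delta> :: real
    using that by (meson not_le)
  interpret Metric_space "form_domain q" "form_dist q"
    by (rule Metric_space_form_dist[OF q])
  define K where "K n = {f. w \<bullet> f = 1 \<and> q f \<le> ennreal (1 / real (Suc n))}" for n
  have "decseq K"
    unfolding decseq_def K_def by (auto elim!: order_trans intro!: ennreal_leI frac_le)
  moreover have "(1/2) *\<^sub>R (x + y) \<in> K n" if "x \<in> K n" "y \<in> K n" for n x y
    using that form_midpoint_le[OF q] by (auto simp: K_def inner_add_right)
  moreover have "\<exists>x\<in>K n. norm x \<le> M" for n
    using bad[of "1 / real (Suc n)"] by (auto simp: K_def)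
  ultimately obtain g where g: "\<And>n. g n \<in> K n" and Cauchy: "Cauchy g"
    using nested_midconvex_Cauchy_selection[of K M] by blast
  have wg: "w \<bullet> g n = 1" and qg: "q (g n) \<le> ennreal (1 / real (Suc n))" for n
    using g by (auto simp: K_def)
  have dom: "g n \<in> form_domain q" for n
    using qg[of n] by (auto simp: form_domain_def intro: le_less_trans)
  \<comment> \<open>The form part of the distance is small because the values of \<open>q\<close>
    themselves are: 2 + 2 = 4 by the parallelogram law.\<close>
  have qdiff: "enn2real (q (g m - g n)) \<le> 4 / real (Suc N)" if "N \<le> m" "N \<le> n" for N m n
  proof -
    have qN: "q (g k) \<le> ennreal (1 / real (Suc N))" if "N \<le> k" for k
      using qg[of k] that by (auto elim!: order_trans intro!: ennreal_leI frac_le)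
    have "q (g m - g n) \<le> 2 * q (g m) + 2 * q (g n)"
      by (rule form_add_le[OF q])
    also have "\<dots> \<le> 2 * ennreal (1 / real (Suc N)) + 2 * ennreal (1 / real (Suc N))"
      using qN that by (intro add_mono mult_left_mono) auto
    also have "\<dots> = ennreal (4 / real (Suc N))"
      by (simp flip: ennreal_numeral ennreal_mult ennreal_plus)
    finally show ?thesis
      by (intro enn2real_leI) auto
  qed
  have "MCauchy g"
    unfolding MCauchy_def
  proof (intro conjI allI impI)
    show "range g \<subseteq> form_domain q"
      using dom by auto
    fix e :: real assume e: "0 < e"
    have lim: "(\<lambda>N. sqrt (4 / real (Suc N))) \<longlonglongrightarrow> sqrt 0"
      by (intro tendsto_intros LIMSEQ_Suc[OF lim_const_over_n])
    obtain N1 where N1: "\<And>n. n \<ge> N1 \<Longrightarrow> sqrt (4 / real (Suc n)) < e / 2"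
      using order_tendstoD(2)[OF lim, of "e / 2"] e by (auto simp: eventually_sequentially)
    obtain N2 where N2: "\<And>m n. m \<ge> N2 \<Longrightarrow> n \<ge> N2 \<Longrightarrow> norm (g m - g n) < e / 2"
      using CauchyD[OF Cauchy, of "e / 2"] e by auto
    show "\<exists>N. \<forall>n n'. N \<le> n \<longrightarrow> N \<le> n' \<longrightarrow> form_dist q (g n) (g n') < e"
    proof (intro exI allI impI)
      fix m n assume mn: "max N1 N2 \<le> m" "max N1 N2 \<le> n"
      then have "sqrt (enn2real (q (g m - g n))) \<le> sqrt (4 / real (Suc N1))"
        by (intro real_sqrt_le_mono qdiff) auto
      moreover have "norm (g m - g n) < e / 2"
        using N2 mn by simp
      ultimately show "form_dist q (g m) (g n) < e"
        using N1[OF order_refl] unfolding form_dist_def by linarith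
    qed
  qed
  then obtain h where "limitin mtopology g h sequentially"
    using closed unfolding closed_form_def mcomplete_def by blast
  then have h: "h \<in> form_domain q" and lim: "(\<lambda>n. form_dist q (g n) h) \<longlonglongrightarrow> 0"
    by (auto simp: limitin_metric_dist_null)
  \<comment> \<open>The norm is a summand of the form distance, so the limit is also a norm limit
    and inherits the constraint on \<open>w\<close>.\<close>
  have "(\<lambda>n. g n - h) \<longlonglongrightarrow> 0"
    by (rule Lim_null_comparison[OF _ lim]) (simp add: form_dist_def)
  then have "g \<longlonglongrightarrow> h"
    by (simp add: LIM_zero_iff)
  then have "(\<lambda>n. w \<bullet> g n) \<longlonglongrightarrow> w \<bullet> h"
    by (intro tendsto_intros)
  then have "w \<bullet> h = 1"
    using wg by (simp add: LIMSEQ_const_iff)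
  \<comment> \<open>The triangle inequality for the square root of \<open>q\<close> does the work of
    lower semicontinuity: both terms on the right tend to 0.\<close>
  have bound: "sqrt (enn2real (q h)) \<le> form_dist q (g n) h + sqrt (1 / real (Suc n))" for n
  proof -
    have "sqrt (enn2real (q (h - g n + g n))) \<le> sqrt (enn2real (q (h - g n))) + sqrt (enn2real (q (g n)))"
      using q h dom by (intro sqrt_form_triangle form_domain_add_diff) auto
    also have "sqrt (enn2real (q (h - g n))) \<le> form_dist q (g n) h"
      using commute[of "g n" h] by (simp add: form_dist_def)
    also have "sqrt (enn2real (q (g n))) \<le> sqrt (1 / real (Suc n))"
      using qg by (intro real_sqrt_le_mono enn2real_leI) auto
    finally show ?thesis by simp
  qed
  have "(\<lambda>n. form_dist q (g n) h + sqrt (1 / real (Suc n))) \<longlonglongrightarrow> 0 + sqrt 0"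
    by (intro tendsto_intros lim LIMSEQ_Suc[OF lim_const_over_n])
  then have "sqrt (enn2real (q h)) \<le> 0"
    using bound by (intro LIMSEQ_le_const[of _ "0::real"]) auto
  then have "enn2real (q h) = 0"
    by (metis enn2real_nonneg order_antisym real_sqrt_le_0_iff)
  \<comment> \<open>Since \<open>enn2real\<close> sends infinity to 0 as well,
    \<open>q h = 0\<close> follows only because \<open>h\<close> lies in the domain.\<close>
  then have "h \<in> form_kernel q"
    using h by (auto simp: form_kernel_def form_domain_def enn2real_eq_0_iff)
  then have "w \<bullet> h = 0"
    using w by (auto simp: orthogonal_comp_def orthogonal_def inner_commute)
  with \<open>w \<bullet> h = 1\<close> show False by simp
qed

lemma exists_constant_for_fixed_r:
  fixes q \<Phi> :: "'a::real_inner \<Rightarrow> ennreal"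
  assumes q: "quadratic_form q" and closed: "closed_form q" and \<Phi>: "sublinear \<Phi>"
    and bdd: "\<And>R::real. R \<ge> 0 \<Longrightarrow> bounded {f. \<Phi> f \<le> ennreal R}"
    and w: "w \<in> orthogonal_comp (form_kernel q)" and r: "r > 0"
  shows "\<exists>a>0. \<forall>f. ennreal (\<bar>w \<bullet> f\<bar>\<^sup>2) \<le> ennreal a * q f + ennreal r * (\<Phi> f)\<^sup>2"
proof -
  \<comment> \<open>The level is the one at which
    \<open>r * (1 / sqrt r)\<^sup>2 = 1\<close>.\<close>
  obtain M where M: "\<And>f. \<Phi> f \<le> ennreal (1 / sqrt r) \<Longrightarrow> norm f \<le> M"
    using bdd[of "1 / sqrt r"] r by (auto simp: bounded_iff)
  obtain \<delta> :: real where \<delta>: "\<delta> > 0" "\<And>f. w \<bullet> f = 1 \<Longrightarrow> norm f \<le> M \<Longrightarrow> ennreal \<delta> < q f"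
    using form_bounded_below_on_slice[OF q closed w] by blast
  have "ennreal (\<bar>w \<bullet> f\<bar>\<^sup>2) \<le> ennreal (1 / \<delta>) * q f + ennreal r * (\<Phi> f)\<^sup>2" for f
  proof (cases "w \<bullet> f = 0")
    case False
    define t where "t = w \<bullet> f"
    have t: "t \<noteq> 0" using False by (simp add: t_def)
    \<comment> \<open>\<open>\<Phi>\<close> is homogeneous for positive factors only and need not be
      even, so it is tested at the scaling by \<open>1 / \<bar>t\<bar>\<close>. The norm ignores the
      sign, so the bound passes to the scaling by \<open>1 / t\<close>, which lies on the
      slice.\<close>
    show ?thesis
    proof (cases "\<Phi> ((1 / \<bar>t\<bar>) *\<^sub>R f) \<le> ennreal (1 / sqrt r)")
      case True
      then have "norm ((1 / t) *\<^sub>R f) \<le> M"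
        using M by fastforce
      moreover have "w \<bullet> ((1 / t) *\<^sub>R f) = 1"
        using t by (simp add: t_def)
      ultimately have le: "ennreal \<delta> \<le> q ((1 / t) *\<^sub>R f)"
        using \<delta>(2) by (simp add: less_imp_le)
      have "ennreal (t\<^sup>2) = ennreal (1 / \<delta>) * ennreal (t\<^sup>2) * ennreal \<delta>"
        using \<delta>(1) by (simp flip: ennreal_mult)
      also have "\<dots> \<le> ennreal (1 / \<delta>) * ennreal (t\<^sup>2) * q ((1 / t) *\<^sub>R f)"
        using le by (intro mult_left_mono) auto
      also have "\<dots> = ennreal (1 / \<delta>) * q (t *\<^sub>R (1 / t) *\<^sub>R f)"
        using q unfolding quadratic_form_def by (simp only: mult.assoc)
      also have "\<dots> = ennreal (1 / \<delta>) * q f"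
        using t by simp
      finally show ?thesis
        by (simp add: t_def add_increasing2)
    next
      case False
      have "ennreal \<bar>t\<bar> * ennreal (1 / sqrt r) \<le> ennreal \<bar>t\<bar> * \<Phi> ((1 / \<bar>t\<bar>) *\<^sub>R f)"
        using False by (intro mult_left_mono) auto
      also have "\<dots> = \<Phi> (\<bar>t\<bar> *\<^sub>R (1 / \<bar>t\<bar>) *\<^sub>R f)"
        using \<Phi> t unfolding sublinear_def by (metis zero_less_abs_iff)
      also have "\<dots> = \<Phi> f"
        using t by simp
      finally have "(ennreal (\<bar>t\<bar> / sqrt r))\<^sup>2 \<le> (\<Phi> f)\<^sup>2"
        using r by (intro power_mono) (auto simp flip: ennreal_mult)
      then have "ennreal r * ennreal ((\<bar>t\<bar> / sqrt r)\<^sup>2) \<le> ennreal r * (\<Phi> f)\<^sup>2"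
        using r by (intro mult_left_mono) (auto simp: ennreal_power)
      moreover have "ennreal r * ennreal ((\<bar>t\<bar> / sqrt r)\<^sup>2) = ennreal (\<bar>t\<bar>\<^sup>2)"
        using r by (simp add: power_divide flip: ennreal_mult)
      ultimately show ?thesis
        by (simp add: t_def add_increasing)
    qed
  qed simp
  with \<delta>(1) show ?thesis
    by (intro exI[of _ "1 / \<delta>"]) auto
qed

theorem theorem4p2:
  fixes q \<Phi> :: "'a::{real_inner, complete_space} \<Rightarrow> ennreal"
    and w :: 'a
  assumes "quadratic_form q" and "closed_form q"
    and "sublinear \<Phi>"
    and "\<And>R::real. R \<ge> 0 \<Longrightarrow> closed {f. \<Phi> f \<le> ennreal R} \<and> bounded {f. \<Phi> f \<le> ennreal R}"
    and "w \<in> orthogonal_comp (form_kernel q)"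
  shows "\<exists>\<alpha> :: real \<Rightarrow> real.
           (\<forall>r>0. \<alpha> r > 0) \<and> antimono_on {0<..} \<alpha> \<and>
           (\<forall>r>0. \<forall>f. ennreal (\<bar>w \<bullet> f\<bar>\<^sup>2) \<le> ennreal (\<alpha> r) * q f + ennreal r * (\<Phi> f)\<^sup>2)"
proof -
  \<comment> \<open>Constants chosen separately for each \<open>r\<close> need not decrease; the set
    of all of them grows with \<open>r\<close>, so its infimum does.\<close>
  define S where "S r = {a. 0 < a \<and>
    (\<forall>f. ennreal (\<bar>w \<bullet> f\<bar>\<^sup>2) \<le> ennreal a * q f + ennreal r * (\<Phi> f)\<^sup>2)}" for r :: real
  have ne: "S r \<noteq> {}" if "r > 0" for r
    using exists_constant_for_fixed_r[OF assms(1-3) _ assms(5) that] assms(4) by (auto simp: S_def)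
  have bb: "bdd_below (S r)" for r
    by (rule bdd_belowI[of _ 0]) (auto simp: S_def)
  have S_mono: "S r \<subseteq> S s" if "r \<le> s" for r s
    using that unfolding S_def
    by (auto elim!: all_forward order_trans intro!: add_left_mono mult_right_mono ennreal_leI)
  show ?thesis
  proof (intro exI[of _ "\<lambda>r. Inf (S r) + 1"] conjI allI impI)
    show "0 < Inf (S r) + 1" if "r > 0" for r
      using cInf_greatest[OF ne[OF that], of 0] by (auto simp: S_def)
    show "antimono_on {0<..} (\<lambda>r. Inf (S r) + 1)"
      using ne bb S_mono by (intro monotone_onI add_right_mono cInf_superset_mono) auto
    fix r :: real and f assume "r > 0"
    \<comment> \<open>The infimum may not be attained or may be 0, but some admissible constant lies
      below \<open>Inf (S r) + 1\<close>, and enlarging a constant keeps the inequality.\<close>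
    then obtain a where a: "a \<in> S r" "a < Inf (S r) + 1"
      using cInf_lessD[OF ne, of r "Inf (S r) + 1"] by auto
    then have "ennreal (\<bar>w \<bullet> f\<bar>\<^sup>2) \<le> ennreal a * q f + ennreal r * (\<Phi> f)\<^sup>2"
      by (simp add: S_def)
    also have "\<dots> \<le> ennreal (Inf (S r) + 1) * q f + ennreal r * (\<Phi> f)\<^sup>2"
      using a by (intro add_right_mono mult_right_mono ennreal_leI) auto
    finally show "ennreal (\<bar>w \<bullet> f\<bar>\<^sup>2) \<le> ennreal (Inf (S r) + 1) * q f + ennreal r * (\<Phi> f)\<^sup>2" .
  qed
qed

end
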